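(* Let $L\ge1$. Every pure fermionic Gaussian state $|\psi\rangle$ on $L$ qubits can be generated by at most $\lfloor L^2/4\rfloor$ matchgates acting on a computational basis state; that is, there are a computational basis state $|x\rangle$, $x\in\{0,1\}^L$, and a product $U$ of at most $\lfloor L^2/4\rfloor$ nearest-neighbor matchgates with $|\psi\rangle=U|x\rangle$.
   Context: Matchgate: a two-qubit unitary acting on nearest-neighbor qubits of a line $1,\dots,L$ which in the basis $|00\rangle,|01\rangle,|10\rangle,|11\rangle$ has the form $$G(A,B)=\begin{pmatrix} a_{11} & 0 & 0 & a_{12} \\ 0 & b_{11} & b_{12} & 0 \\ 0 & b_{21} & b_{22} & 0 \\ a_{21} & 0 & 0 & a_{22} \end{pmatrix}$$ with $A=(a_{ij})$, $B=(b_{ij})$ unitary $2\times2$ matrices and $\det A=\det B$. A pure state on $L$ qubits is a (pure) fermionic Gaussian state if it can be generated by a circuit (finite product) of nearest-neighbor matchgates acting on a computational basis state. *)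

theory Defs
  imports "Jordan_Normal_Form.Schur_Decomposition"
begin

definition unitary_mat :: "nat \<Rightarrow> complex mat \<Rightarrow> bool" where
  "unitary_mat n A \<longleftrightarrow> A \<in> carrier_mat n n \<and> mat_adjoint A * A = 1\<^sub>m n"

definition kron :: "complex mat \<Rightarrow> complex mat \<Rightarrow> complex mat" where
  "kron A B = mat (dim_row A * dim_row B) (dim_col A * dim_col B)
     (\<lambda>(i, j). A $$ (i div dim_row B, j div dim_col B) * B $$ (i mod dim_row B, j mod dim_col B))"

text \<open>
  A bit string is a Boolean list whose head is the qubit at site 1.  Basis vectors are ordered
  lexicographically (the head is the most significant bit), which is the order
  \<open>00, 01, 10, 11\<close> for two qubits and the order that \<^term>\<open>kron\<close> induces.
\<close>

definition bits_index :: "bool list \<Rightarrow> nat" where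
  "bits_index x = horner_sum of_bool 2 (rev x)"

definition ket :: "bool list \<Rightarrow> complex vec" where
  "ket x = unit_vec (2 ^ length x) (bits_index x)"

definition matchgate :: "complex mat \<Rightarrow> complex mat \<Rightarrow> complex mat" where
  "matchgate A B = mat_of_rows_list 4
     [[A $$ (0,0), 0,           0,           A $$ (0,1)],
      [0,          B $$ (0,0), B $$ (0,1), 0         ],
      [0,          B $$ (1,0), B $$ (1,1), 0         ],
      [A $$ (1,0), 0,           0,           A $$ (1,1)]]"

definition matchgates :: "complex mat set" where
  "matchgates = {matchgate A B | A B. unitary_mat 2 A \<and> unitary_mat 2 B \<and> det A = det B}"

text \<open>The two-qubit gate \<open>G\<close> acting on the qubits \<open>j\<close> and \<open>j + 1\<close> of the line \<open>1, ..., L\<close>.\<close>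

definition local_gate :: "nat \<Rightarrow> nat \<Rightarrow> complex mat \<Rightarrow> complex mat" where
  "local_gate L j G = kron (kron (1\<^sub>m (2 ^ (j - 1))) G) (1\<^sub>m (2 ^ (L - 1 - j)))"

definition nn_matchgates :: "nat \<Rightarrow> complex mat set" where
  "nn_matchgates L = {local_gate L j G | j G. 1 \<le> j \<and> j < L \<and> G \<in> matchgates}"

definition circuit :: "nat \<Rightarrow> complex mat list \<Rightarrow> complex mat" where
  "circuit L Us = foldr (*) Us (1\<^sub>m (2 ^ L))"

definition fermionic_gaussian_state :: "nat \<Rightarrow> complex vec \<Rightarrow> bool" where
  "fermionic_gaussian_state L \<psi> \<longleftrightarrow>
     (\<exists>x Us. length x = L \<and> set Us \<subseteq> nn_matchgates L \<and> \<psi> = circuit L Us *\<^sub>v ket x)"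

lemma bits_index_less: "bits_index x < 2 ^ length x"
  using horner_sum_of_bool_2_less[of "rev x"] by (simp add: bits_index_def)

lemma bits_index_append: "bits_index (x @ y) = bits_index x * 2 ^ length y + bits_index y"
  by (simp add: bits_index_def horner_sum_append)

lemma bits_index_eq_iff:
  "length x = length y \<Longrightarrow> bits_index x = bits_index y \<longleftrightarrow> x = y"
proof (induction x y rule: list_induct2)
  case (Cons a x b y)
  have "bits_index (a # x) = of_bool a * 2 ^ length y + bits_index x"
       "bits_index (b # y) = of_bool b * 2 ^ length y + bits_index y"
    using bits_index_append[of "[a]" x] bits_index_append[of "[b]" y] Cons.hyps
    by (simp_all add: bits_index_def)
  then show ?case
    using bits_index_less[of x] bits_index_less[of y] Cons by (cases a; cases b; auto)
qed simp

lemma dim_local_gate: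
  assumes "G \<in> carrier_mat 4 4" "1 \<le> j" "j < L"
  shows "local_gate L j G \<in> carrier_mat (2 ^ L) (2 ^ L)"
proof -
  have "(2::nat) ^ L = 2 ^ ((j - 1) + 2 + (L - 1 - j))"
    using assms by simp
  then show ?thesis
    using assms(1) unfolding local_gate_def kron_def power_add by auto
qed

text \<open>The matrix elements of a local gate with respect to bit strings.\<close>

lemma local_gate_index:
  assumes G: "G \<in> carrier_mat 4 4" and j: "1 \<le> j" "j < L"
    and len: "length x = j - 1" "length x' = j - 1" "length u = 2" "length v = 2"
      "length y = L - 1 - j" "length y' = L - 1 - j"
  shows "local_gate L j G $$ (bits_index (x @ u @ y), bits_index (x' @ v @ y')) =
    (if x = x' \<and> y = y' then G $$ (bits_index u, bits_index v) else 0)"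
proof -
  let ?m = "2 ^ (j - 1) :: nat" and ?n = "2 ^ (L - 1 - j) :: nat"
  have b: "bits_index u < 4" "bits_index v < 4" "bits_index x < ?m" "bits_index x' < ?m"
      "bits_index y < ?n" "bits_index y' < ?n"
    using bits_index_less[of u] bits_index_less[of v] bits_index_less[of x] bits_index_less[of x']
      bits_index_less[of y] bits_index_less[of y'] len by simp_all
  have lt: "a * 4 + c < ?m * 4" if "a < ?m" "c < 4" for a c :: nat
    using that by linarith
  have lt': "a * ?n + c < ?m * 4 * ?n" if "a < ?m * 4" "c < ?n" for a c :: nat
  proof -
    have "a * ?n + c < (a + 1) * ?n" using that by simp
    also have "\<dots> \<le> ?m * 4 * ?n" using that by (intro mult_right_mono) auto
    finally show ?thesis .
  qed
  have i: "bits_index (x @ u @ y) = (bits_index x * 4 + bits_index u) * ?n + bits_index y"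
    "bits_index (x' @ v @ y') = (bits_index x' * 4 + bits_index v) * ?n + bits_index y'"
    using bits_index_append[of "x @ u" y] bits_index_append[of x u]
      bits_index_append[of "x' @ v" y'] bits_index_append[of x' v] len by simp_all
  have eq: "bits_index x = bits_index x' \<longleftrightarrow> x = x'" "bits_index y = bits_index y' \<longleftrightarrow> y = y'"
    using len by (simp_all add: bits_index_eq_iff)
  show ?thesis
    unfolding i local_gate_def kron_def
    using G b lt[OF b(3,1)] lt[OF b(4,2)] lt'[OF lt[OF b(3,1)] b(5)] lt'[OF lt[OF b(4,2)] b(6)]
    by (auto simp: eq)
qed

end

theory Submission
  imports Defs
begin

text \<open>
  In the Jordan-Wigner picture an \<open>L\<close>-qubit state \<open>\<psi>\<close> has a space of annihilators, the linear
  combinations of creation and annihilation operators that kill \<open>\<psi>\<close>; matchgates act on it linearly,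
  so for a Gaussian state its dimension is at least \<open>L\<close>, as for a basis state.  Hence some nonzero
  annihilator is supported on the first \<open>L div 2 + 1\<close> sites.  A matchgate on sites \<open>k, k + 1\<close> can
  clear the component of a given annihilator at site \<open>k + 1\<close>, so \<open>L div 2\<close> gates bring it to the
  first site, which makes the first qubit a basis state and leaves an \<open>(L - 1)\<close>-qubit state of the
  same kind.  The gate counts \<open>L div 2\<close> add up to \<open>L\<^sup>2 div 4\<close>.  This works up to a global phase,
  which is absorbed into a gate if \<open>L \<ge> 2\<close>; for \<open>L = 1\<close> there are no gates at all.
\<close>

section \<open>Gates and fermionic operators on amplitudes\<close>

text \<open>
  A state is given by its amplitudes on bit strings, and a \<open>2 \<times> 2\<close> matrix by a function on Booleans.
  Sites are counted from \<open>0\<close>.  In both parity sectors of two qubits the first bit serves as the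
  index into \<open>A\<close> or \<open>B\<close>.
\<close>

fun gate_action ::
    "nat \<Rightarrow> (bool \<Rightarrow> bool \<Rightarrow> complex) \<Rightarrow> (bool \<Rightarrow> bool \<Rightarrow> complex) \<Rightarrow>
     (bool list \<Rightarrow> complex) \<Rightarrow> bool list \<Rightarrow> complex" where
  "gate_action 0 A B f (a # b # q) =
     (if a = b then A else B) a False * f (False # (a \<noteq> b) # q) +
     (if a = b then A else B) a True * f (True # (a = b) # q)"
| "gate_action (Suc j) A B f (a # q) = gate_action j A B (\<lambda>y. f (a # y)) q"
| "gate_action _ A B f _ = 0"

text \<open>
  The operator \<open>\<Sum>k. w k False a\<^sub>k + w k True a\<^sub>k\<^sup>\<dagger>\<close> with the Jordan-Wigner signs: \<open>w k b\<close> is the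
  coefficient of the term whose output has bit \<open>b\<close> at site \<open>k\<close>.
\<close>

fun fermion_op :: "(nat \<Rightarrow> bool \<Rightarrow> complex) \<Rightarrow> (bool list \<Rightarrow> complex) \<Rightarrow> bool list \<Rightarrow> complex" where
  "fermion_op w f [] = 0"
| "fermion_op w f (b # x) = w 0 b * f ((\<not> b) # x) +
     (if b then - 1 else 1) * fermion_op (\<lambda>k. w (Suc k)) (\<lambda>y. f (b # y)) x"

definition det2 :: "(bool \<Rightarrow> bool \<Rightarrow> complex) \<Rightarrow> complex" where
  "det2 A = A False False * A True True - A False True * A True False"

definition unitary2 :: "(bool \<Rightarrow> bool \<Rightarrow> complex) \<Rightarrow> bool" where
  "unitary2 A \<longleftrightarrow>
     (\<forall>a b. cnj (A False a) * A False b + cnj (A True a) * A True b = of_bool (a = b))"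

definition gate_pair :: "(bool \<Rightarrow> bool \<Rightarrow> complex) \<Rightarrow> (bool \<Rightarrow> bool \<Rightarrow> complex) \<Rightarrow> bool" where
  "gate_pair A B \<longleftrightarrow> unitary2 A \<and> unitary2 B \<and> det2 A = det2 B"

text \<open>
  The matrix, from even to odd two-qubit states, of the operator with coefficients \<open>u\<close> at the first
  and \<open>v\<close> at the second site; \<open>conj_block A B N\<close> below is \<open>B N A\<inverse>\<close>.
\<close>

definition parity_block :: "(bool \<Rightarrow> complex) \<Rightarrow> (bool \<Rightarrow> complex) \<Rightarrow> bool \<Rightarrow> bool \<Rightarrow> complex" where
  "parity_block u v a c = (if c = a then (if a then - 1 else 1) * v (\<not> a) else u a)"

definition conj_block :: "(bool \<Rightarrow> bool \<Rightarrow> complex) \<Rightarrow> (bool \<Rightarrow> bool \<Rightarrow> complex) \<Rightarrow>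
    (bool \<Rightarrow> bool \<Rightarrow> complex) \<Rightarrow> bool \<Rightarrow> bool \<Rightarrow> complex" where
  "conj_block A B N a c = (1 / det2 A) *
     (let u = B a False * N False False + B a True * N True False;
          v = B a False * N False True + B a True * N True True
      in if c then v * A False False - u * A False True else u * A True True - v * A True False)"

text \<open>Undoes \<open>parity_block\<close> after the conjugation: the antidiagonal of the new
  block holds the coefficients at site \<open>j\<close>, the diagonal those at site
  \<open>j + 1\<close> up to sign.\<close>

definition rotate_modes :: "nat \<Rightarrow> (bool \<Rightarrow> bool \<Rightarrow> complex) \<Rightarrow> (bool \<Rightarrow> bool \<Rightarrow> complex) \<Rightarrow>
    (nat \<Rightarrow> bool \<Rightarrow> complex) \<Rightarrow> nat \<Rightarrow> bool \<Rightarrow> complex" where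
  "rotate_modes j A B w = (let N = conj_block A B (parity_block (w j) (w (Suc j))) in
     w(j := \<lambda>a. N a (\<not> a), Suc j := \<lambda>a. (if a then 1 else - 1) * N (\<not> a) (\<not> a)))"

section \<open>Linearity, locality and inversion of the two actions\<close>

lemma gate_action_cong:
  assumes "\<And>y. length y = length x \<Longrightarrow> f y = g y"
  shows "gate_action j A B f x = gate_action j A B g x"
  using assms
proof (induction j arbitrary: x f g)
  case 0
  then show ?case by (cases x rule: remdups_adj.cases) auto
next
  case (Suc j)
  show ?case
  proof (cases x)
    case (Cons a y)
    have "gate_action j A B (\<lambda>z. f (a # z)) y = gate_action j A B (\<lambda>z. g (a # z)) y"
      by (rule Suc.IH, rule Suc.prems) (simp add: Cons)
    then show ?thesis by (simp add: Cons)
  qed simp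
qed

lemma gate_action_linear:
  "gate_action j A B (\<lambda>y. c * f y + d * g y) x = c * gate_action j A B f x + d * gate_action j A B g x"
proof (induction j arbitrary: x f g)
  case 0
  then show ?case by (cases x rule: remdups_adj.cases) (auto simp: algebra_simps)
next
  case (Suc j)
  then show ?case by (cases x) auto
qed

lemma gate_action_scale:
  "gate_action j A B (\<lambda>y. c * f y) x = c * gate_action j A B f x"
  using gate_action_linear[of j A B c f 0 f x] by simp

lemma gate_action_zero: "gate_action j A B (\<lambda>y. 0) x = 0"
  using gate_action_scale[of j A B 0 "\<lambda>y. 0" x] by simp

lemma gate_action_scale_gate:
  "gate_action j (\<lambda>a b. c * A a b) (\<lambda>a b. c * B a b) f x = c * gate_action j A B f x"
proof (induction j arbitrary: x f)
  case 0
  then show ?case by (cases x rule: remdups_adj.cases) (auto simp: algebra_simps)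
next
  case (Suc j)
  then show ?case by (cases x) auto
qed

lemma gate_action_append:
  "gate_action (length p) A B f (p @ q) = gate_action 0 A B (\<lambda>y. f (p @ y)) q"
  by (induction p arbitrary: f) simp_all

lemma fermion_op_cong:
  assumes "\<And>y. length y = length x \<Longrightarrow> f y = g y"
  shows "fermion_op w f x = fermion_op w g x"
  using assms
proof (induction x arbitrary: w f g)
  case (Cons b x)
  from Cons.IH[of "\<lambda>y. f (b # y)" "\<lambda>y. g (b # y)"] Cons.prems show ?case by auto
qed simp

lemma fermion_op_linear:
  "fermion_op w (\<lambda>y. c * f y + d * g y) x = c * fermion_op w f x + d * fermion_op w g x"
  by (induction x arbitrary: w f g) (simp_all add: algebra_simps)

lemma fermion_op_zero: "(\<And>y. length y = length x \<Longrightarrow> f y = 0) \<Longrightarrow> fermion_op w f x = 0"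
  using fermion_op_cong[of x f "\<lambda>y. 0 * f y + 0 * f y" w] fermion_op_linear[of w 0 f 0 f x] by simp

lemma gate_action_inverse:
  assumes "\<And>a b. A' a False * A False b + A' a True * A True b = of_bool (a = b)"
    and "\<And>a b. B' a False * B False b + B' a True * B True b = of_bool (a = b)"
    and "Suc j < length x"
  shows "gate_action j A' B' (gate_action j A B f) x = f x"
  using assms(3)
proof (induction j arbitrary: x f)
  case 0
  then obtain a b q where x: "x = a # b # q" by (cases x rule: remdups_adj.cases) auto
  have *: "p * (k * s + l * t) + q * (m * s + n * t) = (p * k + q * m) * s + (p * l + q * n) * t"
    for p q k l m n s t :: complex
    by (simp add: algebra_simps)
  show ?case
    unfolding x using assms(1)[of a] assms(2)[of a]
    by (cases "a = b"; cases a; cases b; simp add: *)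
next
  case (Suc j)
  then show ?case by (cases x) auto
qed

text \<open>The formula for \<open>conj_block\<close> multiplies by the adjugate of \<open>A\<close>
  and divides by \<open>det2 A\<close>, which is multiplication by the inverse of
  \<open>A\<close>.\<close>

lemma conj_block_mult:
  assumes "det2 A \<noteq> 0"
  shows "conj_block A B N a False * A False c + conj_block A B N a True * A True c =
    B a False * N False c + B a True * N True c"
proof -
  define D where "D = 1 / det2 A"
  have "conj_block A B N a False * A False c + conj_block A B N a True * A True c =
      (B a False * N False c + B a True * N True c) * (D * det2 A)"
    unfolding conj_block_def D_def[symmetric] unfolding det2_def
    by (cases c) (simp_all add: Let_def algebra_simps)
  then show ?thesis
    using assms by (simp add: D_def)
qed

text \<open>Adjugates reverse products, so the adjugate of \<open>B N A\<inverse>\<close> is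
  \<open>A (adj N) B\<inverse>\<close> times the factor \<open>det2 B / det2 A\<close>, which is 1
  here.\<close>

lemma adj_conj_block_mult:
  fixes A B N
  defines "adj \<equiv> \<lambda>N a c. if c = a then N (\<not> a) (\<not> a) else - (N a c :: complex)"
  assumes "det2 A = det2 B" "det2 A \<noteq> 0"
  shows "adj (conj_block A B N) a False * B False c + adj (conj_block A B N) a True * B True c =
    A a False * adj N False c + A a True * adj N True c"
proof -
  define D where "D = 1 / det2 A"
  have "adj (conj_block A B N) a False * B False c + adj (conj_block A B N) a True * B True c =
      (A a False * adj N False c + A a True * adj N True c) * (D * det2 B)"
    unfolding conj_block_def D_def[symmetric] adj_def unfolding det2_def
    by (cases a; cases c; simp add: Let_def algebra_simps)
  then show ?thesis
    using assms by (simp add: D_def)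
qed

text \<open>
  Conjugating with a gate turns the block of a linear operator from even to odd two-qubit states
  into \<open>B N A\<inverse>\<close>.  The block from odd to even states is minus the adjugate of \<open>N\<close>, so equality of
  the determinants is what makes the conjugated operator linear again.
\<close>

lemma gate_action_fermion_op:
  assumes d: "det2 A = det2 B" "det2 A \<noteq> 0" and "Suc j < length x"
  shows "gate_action j A B (fermion_op w f) x =
    fermion_op (rotate_modes j A B w) (gate_action j A B f) x"
  using assms(3)
proof (induction j arbitrary: x w f)
  case 0
  then obtain a b q where x: "x = a # b # q" by (cases x rule: remdups_adj.cases) auto
  define N where "N = parity_block (w 0) (w (Suc 0))"
  define N' where "N' = conj_block A B N"
  define adj :: "(bool \<Rightarrow> bool \<Rightarrow> complex) \<Rightarrow> bool \<Rightarrow> bool \<Rightarrow> complex"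
    where "adj = (\<lambda>N a c. if c = a then N (\<not> a) (\<not> a) else - N a c)"
  define E where "E a b = fermion_op (\<lambda>k. w (Suc (Suc k))) (\<lambda>y. f (a # b # y)) q" for a b
  have odd: "N' a False * A False c + N' a True * A True c =
      B a False * N False c + B a True * N True c" for a c
    unfolding N'_def by (rule conj_block_mult[OF d(2)])
  have even: "adj N' a False * B False c + adj N' a True * B True c =
      A a False * adj N False c + A a True * adj N True c" for a c
    unfolding N'_def adj_def by (rule adj_conj_block_mult[OF d])
  have w: "w 0 a = N a (\<not> a)" "w (Suc 0) a = (if a then 1 else - 1) * N (\<not> a) (\<not> a)" for a
    by (simp_all add: N_def parity_block_def)
  have w': "rotate_modes 0 A B w 0 a = N' a (\<not> a)"
    "rotate_modes 0 A B w (Suc 0) a = (if a then 1 else - 1) * N' (\<not> a) (\<not> a)"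
    "(\<lambda>k. rotate_modes 0 A B w (Suc (Suc k))) = (\<lambda>k. w (Suc (Suc k)))" for a
    by (auto simp: rotate_modes_def N'_def N_def Let_def)
  \<comment> \<open>The tail \<open>E\<close> passes both sites with sign plus at even and minus at
    odd outputs. A gate preserves this parity, so only the blocks \<open>N\<close> and
    \<open>- adj N\<close> change.\<close>
  have M: "fermion_op w f (a # b # q) = (if a = b
      then E a b - (adj N a False * f (False # True # q) + adj N a True * f (True # False # q))
      else N a False * f (False # False # q) + N a True * f (True # True # q) - E a b)" for a b
    by (cases a; cases b; simp add: w E_def adj_def)
  have M': "fermion_op (rotate_modes 0 A B w) g (a # b # q) = (if a = b
      then fermion_op (\<lambda>k. w (Suc (Suc k))) (\<lambda>y. g (a # b # y)) q -
        (adj N' a False * g (False # True # q) + adj N' a True * g (True # False # q))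
      else N' a False * g (False # False # q) + N' a True * g (True # True # q) -
        fermion_op (\<lambda>k. w (Suc (Suc k))) (\<lambda>y. g (a # b # y)) q)" for g a b
    by (cases a; cases b; simp add: w' adj_def)
  have E': "fermion_op (\<lambda>k. w (Suc (Suc k))) (\<lambda>y. gate_action 0 A B f (a # b # y)) q =
      (if a = b then A else B) a False * E False (a \<noteq> b) + (if a = b then A else B) a True * E True (a = b)"
    by (simp add: fermion_op_linear E_def)
  have comb: "p * (k * s + l * t) + q * (m * s + n * t) = (p * k + q * m) * s + (p * l + q * n) * t"
      "p * (e - (k * s + l * t)) + q * (g - (m * s + n * t)) =
        p * e + q * g - ((p * k + q * m) * s + (p * l + q * n) * t)"
      "p * (k * s + l * t - e) + q * (m * s + n * t - g) =
        (p * k + q * m) * s + (p * l + q * n) * t - (p * e + q * g)"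
    for p q k l m n s t e g :: complex
    by (simp_all add: algebra_simps)
  show ?case
  proof (cases "a = b")
    case True
    then show ?thesis
      unfolding x M' E' by (simp add: M comb even del: fermion_op.simps)
  next
    case False
    then show ?thesis
      unfolding x M' E' by (simp add: M comb odd del: fermion_op.simps)
  qed
next
  case (Suc j)
  then obtain b y where x: "x = b # y" by (cases x) auto
  have r: "(\<lambda>k. rotate_modes (Suc j) A B w (Suc k)) = rotate_modes j A B (\<lambda>k. w (Suc k))"
    "rotate_modes (Suc j) A B w 0 = w 0"
    by (auto simp: rotate_modes_def Let_def)
  have "gate_action (Suc j) A B (fermion_op w f) (b # y) =
      w 0 b * gate_action j A B (\<lambda>z. f ((\<not> b) # z)) y +
      (if b then - 1 else 1) * gate_action j A B (fermion_op (\<lambda>k. w (Suc k)) (\<lambda>z. f (b # z))) y"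
    by (simp only: gate_action.simps fermion_op.simps gate_action_linear)
  also have "gate_action j A B (fermion_op (\<lambda>k. w (Suc k)) (\<lambda>z. f (b # z))) y =
      fermion_op (rotate_modes j A B (\<lambda>k. w (Suc k))) (gate_action j A B (\<lambda>z. f (b # z))) y"
    using Suc.prems by (intro Suc.IH) (simp add: x)
  finally show ?case
    by (simp only: x r gate_action.simps fermion_op.simps)
qed

text \<open>If the rotated coefficients vanish, then so does \<open>B N\<close>, and
  \<open>B\<close> is invertible because it shares the nonzero determinant of
  \<open>A\<close>.\<close>

lemma rotate_modes_nonzero:
  assumes d: "det2 A = det2 B" "det2 A \<noteq> 0" and "w k b \<noteq> 0"
  shows "\<exists>k b. rotate_modes j A B w k b \<noteq> 0"
proof (rule ccontr)
  assume "\<not> ?thesis"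
  then have z: "rotate_modes j A B w k b = 0" for k b by blast
  define N where "N = parity_block (w j) (w (Suc j))"
  define N' where "N' = conj_block A B N"
  have "N' a c = 0" for a c
    using z[of j a] z[of "Suc j" "\<not> a"]
    by (cases a; cases c; simp add: rotate_modes_def N'_def N_def Let_def)
  then have BN: "B a False * N False c + B a True * N True c = 0" for a c
    using conj_block_mult[OF d(2), of B N a c] by (simp add: N'_def)
  \<comment> \<open>The adjugate of \<open>B\<close> times \<open>B N\<close>.\<close>
  have "det2 B * N a c = (if a then B False False else B True True) * (B a False * N False c + B a True * N True c) -
      (if a then B True False else B False True) * (B (\<not> a) False * N False c + B (\<not> a) True * N True c)" for a c
    by (cases a) (simp_all add: det2_def algebra_simps)
  then have "N a c = 0" for a c
    using d BN by simp
  then have "w j a = 0" "w (Suc j) a = 0" for a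
    using parity_block_def[of "w j" "w (Suc j)" a "\<not> a"]
      parity_block_def[of "w j" "w (Suc j)" "\<not> a" "\<not> a"]
    by (auto simp: N_def split: if_splits)
  moreover have "w i a = 0" if "i \<noteq> j" "i \<noteq> Suc j" for i a
    using z[of i a] that by (simp add: rotate_modes_def Let_def)
  ultimately show False
    using assms(3) by (cases "k = j \<or> k = Suc j") auto
qed


text \<open>A zero row completes the \<open>n - 1\<close> equations in \<open>n\<close> unknowns to
  a singular square matrix.\<close>

lemma nonzero_kernel:
  fixes m :: "nat \<Rightarrow> nat \<Rightarrow> complex"
  assumes "0 < n"
  shows "\<exists>c. (\<exists>k<n. c k \<noteq> 0) \<and> (\<forall>i. i + 1 < n \<longrightarrow> (\<Sum>k<n. m i k * c k) = 0)"
proof -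
  define A where "A = mat\<^sub>r n n (\<lambda>i. if i = n - 1 then 0\<^sub>v n else vec n (m i))"
  have A: "A \<in> carrier_mat n n"
    by (simp add: A_def)
  have "det A = 0"
    unfolding A_def by (rule det_row_0) (use assms in auto)
  then obtain v where v: "v \<in> carrier_vec n" "v \<noteq> 0\<^sub>v n" "A *\<^sub>v v = 0\<^sub>v n"
    using det_0_iff_vec_prod_zero[OF A] by blast
  have "\<exists>k<n. v $ k \<noteq> 0"
    using v(1,2) by (metis eq_vecI carrier_vecD index_zero_vec)
  moreover have "(\<Sum>k<n. m i k * v $ k) = 0" if "i + 1 < n" for i
  proof -
    have "0 = (A *\<^sub>v v) $ i"
      using v that by simp
    also have "\<dots> = (\<Sum>k<n. m i k * v $ k)"
      using v(1) that A by (auto simp: A_def scalar_prod_def lessThan_atLeast0 intro!: sum.cong)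
    finally show ?thesis ..
  qed
  ultimately show ?thesis
    by (intro exI[of _ "\<lambda>k. v $ k"]) blast
qed

section \<open>The annihilators of a Gaussian state\<close>

definition linear_functional :: "((nat \<Rightarrow> bool \<Rightarrow> complex) \<Rightarrow> complex) \<Rightarrow> bool" where
  "linear_functional F \<longleftrightarrow>
     (\<forall>w v c. F (\<lambda>k b. w k b + c * v k b) = F w + c * F v)"

text \<open>
  The operators \<open>fermion_op w\<close> on \<open>L\<close> qubits that annihilate \<open>f\<close> form a space of dimension at least
  \<open>L\<close>.  This is expressed by saying that it meets the kernel of any \<open>L - 1\<close> linear functionals.
\<close>

definition gaussian_amplitudes :: "nat \<Rightarrow> (bool list \<Rightarrow> complex) \<Rightarrow> bool" where
  "gaussian_amplitudes L f \<longleftrightarrow> (\<forall>F. (\<forall>i. linear_functional (F i)) \<longrightarrow>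
     (\<exists>w. (\<exists>k b. w k b \<noteq> 0) \<and> (\<forall>k\<ge>L. \<forall>b. w k b = 0) \<and>
       (\<forall>i. i + 1 < L \<longrightarrow> F i w = 0) \<and> (\<forall>x. length x = L \<longrightarrow> fermion_op w f x = 0)))"

lemma linear_functional_sum:
  assumes "linear_functional F"
  shows "F (\<lambda>k b. \<Sum>i<(n::nat). c i * v i k b) = (\<Sum>i<n. c i * F (v i))"
proof (induction n)
  case 0
  \<comment> \<open>Linearity with \<open>c = - 1\<close> yields \<open>F 0 = F 0 - F 0\<close>,
    hence \<open>F 0 = 0\<close>.\<close>
  have "F (\<lambda>k b. 0 + (- 1) * 0) = F (\<lambda>k b. 0) + (- 1) * F (\<lambda>k b. 0)"
    using assms[unfolded linear_functional_def, rule_format, of "\<lambda>k b. 0" "- 1" "\<lambda>k b. 0"] .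
  then show ?case by simp
next
  case (Suc n)
  have "F (\<lambda>k b. (\<Sum>i<n. c i * v i k b) + c n * v n k b) =
      F (\<lambda>k b. \<Sum>i<n. c i * v i k b) + c n * F (v n)"
    using assms unfolding linear_functional_def by metis
  with Suc show ?case by simp
qed

text \<open>At site \<open>k\<close> only the term with output bit \<open>x ! k\<close> survives,
  and that term needs the opposite input bit.\<close>

lemma fermion_op_basis:
  assumes "\<And>k. k < length x \<Longrightarrow> w k (\<not> x ! k) = 0" and "length y = length x"
  shows "fermion_op w (\<lambda>z. c * of_bool (z = x)) y = 0"
  using assms(2,1)
proof (induction y x arbitrary: w c rule: list_induct2)
  case (Cons a y b x)
  \<comment> \<open>The scalar is arbitrary in the induction so that it can absorb the comparison of
    the heads.\<close>
  have "fermion_op (\<lambda>k. w (Suc k)) (\<lambda>z. (c * of_bool (a = b)) * of_bool (z = x)) y = 0"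
    by (rule Cons.IH) (use Cons.prems[of "Suc _"] in auto)
  moreover have "(\<lambda>z. c * of_bool (a # z = b # x)) = (\<lambda>z. (c * of_bool (a = b)) * of_bool (z = x))"
    by auto
  moreover have "w 0 a * of_bool ((\<not> a) = b) = 0"
    using Cons.prems[of 0] by (cases a; cases b; simp)
  ultimately show ?case by auto
qed simp

lemma gaussian_amplitudes_basis:
  assumes "0 < length x"
  shows "gaussian_amplitudes (length x) (\<lambda>y. c * of_bool (y = x))"
  unfolding gaussian_amplitudes_def
proof (intro allI impI)
  fix F :: "nat \<Rightarrow> (nat \<Rightarrow> bool \<Rightarrow> complex) \<Rightarrow> complex"
  assume F: "\<forall>i. linear_functional (F i)"
  \<comment> \<open>\<open>v i\<close> is whichever of \<open>a\<^sub>i\<close> and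
    \<open>a\<^sub>i\<^sup>\<dagger>\<close> kills \<open>x\<close>. On the span of these
    independent operators, fewer functionals than sites have a common nonzero zero.\<close>
  define v where "v i = (\<lambda>k b. of_bool (k = i \<and> b = x ! i) :: complex)" for i
  obtain d where d: "\<exists>k<length x. d k \<noteq> 0"
      "\<And>i. i + 1 < length x \<Longrightarrow> (\<Sum>k<length x. F i (v k) * d k) = 0"
    using nonzero_kernel[OF assms, of "\<lambda>i k. F i (v k)"] by blast
  define w where "w = (\<lambda>k b. \<Sum>i<length x. d i * v i k b)"
  have w: "w k b = (if k < length x \<and> b = x ! k then d k else 0)" for k b
  proof -
    have "w k b = (\<Sum>i<length x. if i = k then (if b = x ! k then d k else 0) else 0)"
      unfolding w_def v_def by (intro sum.cong) auto
    then show ?thesis by simp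
  qed
  have "\<exists>k b. w k b \<noteq> 0"
    using d(1) w by metis
  moreover have "\<forall>k\<ge>length x. \<forall>b. w k b = 0"
    by (simp add: w)
  moreover have "F i w = 0" if "i + 1 < length x" for i
    using linear_functional_sum[of "F i" d v "length x"] F d(2)[OF that]
    by (simp add: w_def mult.commute)
  moreover have "fermion_op w (\<lambda>z. c * of_bool (z = x)) y = 0" if "length y = length x" for y
    using that by (intro fermion_op_basis) (simp_all add: w)
  ultimately show "\<exists>w. (\<exists>k b. w k b \<noteq> 0) \<and> (\<forall>k\<ge>length x. \<forall>b. w k b = 0) \<and>
       (\<forall>i. i + 1 < length x \<longrightarrow> F i w = 0) \<and>
       (\<forall>y. length y = length x \<longrightarrow> fermion_op w (\<lambda>y. c * of_bool (y = x)) y = 0)"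
    by blast
qed

lemma linear_functional_rotate_modes:
  assumes "linear_functional F"
  shows "linear_functional (\<lambda>w. F (rotate_modes j A B w))"
proof -
  define D where "D = 1 / det2 A"
  have "rotate_modes j A B (\<lambda>k b. w k b + c * v k b) =
      (\<lambda>k b. rotate_modes j A B w k b + c * rotate_modes j A B v k b)" for w v c
    unfolding rotate_modes_def conj_block_def D_def[symmetric]
    by (intro ext) (auto simp: parity_block_def Let_def algebra_simps)
  with assms show ?thesis
    by (simp add: linear_functional_def)
qed

text \<open>Functionals are pulled back along \<open>rotate_modes\<close>; an annihilator of
  \<open>f\<close> in the kernels of the pullbacks is rotated to an annihilator of \<open>g\<close>
  in the original kernels.\<close>

lemma gaussian_amplitudes_gate:
  assumes f: "gaussian_amplitudes L f" and d: "det2 A = det2 B" "det2 A \<noteq> 0" and j: "Suc j < L"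
    and g: "\<And>y. length y = L \<Longrightarrow> g y = gate_action j A B f y"
  shows "gaussian_amplitudes L g"
  unfolding gaussian_amplitudes_def
proof (intro allI impI)
  fix F :: "nat \<Rightarrow> (nat \<Rightarrow> bool \<Rightarrow> complex) \<Rightarrow> complex"
  assume "\<forall>i. linear_functional (F i)"
  then have "\<forall>i. linear_functional (\<lambda>w. F i (rotate_modes j A B w))"
    by (simp add: linear_functional_rotate_modes)
  then obtain w k b where w: "w k b \<noteq> 0" "\<forall>k\<ge>L. \<forall>b. w k b = 0"
      "\<forall>i. i + 1 < L \<longrightarrow> F i (rotate_modes j A B w) = 0"
      "\<forall>x. length x = L \<longrightarrow> fermion_op w f x = 0"
    using f unfolding gaussian_amplitudes_def by (elim allE[of _ "\<lambda>i w. F i (rotate_modes j A B w)"]) blast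
  have "fermion_op (rotate_modes j A B w) g x = 0" if x: "length x = L" for x
  proof -
    have "fermion_op (rotate_modes j A B w) g x =
        fermion_op (rotate_modes j A B w) (gate_action j A B f) x"
      by (rule fermion_op_cong) (simp add: g x)
    also have "\<dots> = gate_action j A B (fermion_op w f) x"
      using gate_action_fermion_op[OF d, of j x] j x by simp
    also have "\<dots> = gate_action j A B (\<lambda>y. 0) x"
      by (rule gate_action_cong) (simp add: w(4) x)
    finally show ?thesis
      by (simp add: gate_action_zero)
  qed
  moreover have "\<forall>k\<ge>L. \<forall>b. rotate_modes j A B w k b = 0"
    using w(2) j by (auto simp: rotate_modes_def Let_def)
  ultimately show "\<exists>w. (\<exists>k b. w k b \<noteq> 0) \<and> (\<forall>k\<ge>L. \<forall>b. w k b = 0) \<and>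
       (\<forall>i. i + 1 < L \<longrightarrow> F i w = 0) \<and> (\<forall>x. length x = L \<longrightarrow> fermion_op w g x = 0)"
    using rotate_modes_nonzero[where w = w, OF d w(1), of j] w(3) by (intro exI[of _ "rotate_modes j A B w"]) blast
qed

section \<open>Disentangling the first qubit\<close>

text \<open>The general element of SU(2). With determinant 1 throughout, the determinant condition
  on matchgates holds automatically.\<close>

definition su2 :: "complex \<Rightarrow> complex \<Rightarrow> bool \<Rightarrow> bool \<Rightarrow> complex" where
  "su2 \<alpha> \<beta> a b = (if a then if b then cnj \<alpha> else \<beta> else if b then - cnj \<beta> else \<alpha>)"

lemma unitary2_su2: "\<alpha> * cnj \<alpha> + \<beta> * cnj \<beta> = 1 \<Longrightarrow> unitary2 (su2 \<alpha> \<beta>)"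
  by (simp add: unitary2_def all_bool_eq su2_def algebra_simps)

lemma det2_su2: "\<alpha> * cnj \<alpha> + \<beta> * cnj \<beta> = 1 \<Longrightarrow> det2 (su2 \<alpha> \<beta>) = 1"
  by (simp add: det2_def su2_def algebra_simps)

text \<open>The adjoint of \<open>su2 \<alpha> \<beta>\<close> is again of this form, with
  parameters \<open>cnj \<alpha>\<close> and \<open>- \<beta>\<close>.\<close>

lemma su2_inverse:
  "\<alpha> * cnj \<alpha> + \<beta> * cnj \<beta> = 1 \<Longrightarrow>
    su2 (cnj \<alpha>) (- \<beta>) a False * su2 \<alpha> \<beta> False b + su2 (cnj \<alpha>) (- \<beta>) a True * su2 \<alpha> \<beta> True b = of_bool (a = b)"
  by (cases a; cases b; simp add: su2_def algebra_simps)

lemma normalise_pair: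
  fixes x y :: complex
  assumes "x \<noteq> 0 \<or> y \<noteq> 0"
  obtains r :: complex where "r * x * cnj (r * x) + r * y * cnj (r * y) = 1" "cnj r = r"
proof
  define s where "s = (cmod x)\<^sup>2 + (cmod y)\<^sup>2"
  define r where "r = complex_of_real (1 / sqrt s)"
  have s: "s > 0"
    using assms by (auto simp: s_def sum_power2_gt_zero_iff)
  show r: "cnj r = r"
    by (simp add: r_def)
  have "r * x * cnj (r * x) + r * y * cnj (r * y) = r * r * (x * cnj x + y * cnj y)"
    by (simp add: r algebra_simps)
  also have "x * cnj x + y * cnj y = of_real s"
    by (simp add: s_def flip: complex_norm_square)
  also have "r * r * of_real s = 1"
    using s by (simp add: r_def flip: of_real_mult)
  finally show "r * x * cnj (r * x) + r * y * cnj (r * y) = 1" .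
qed

text \<open>Homogeneous coordinates include the root at infinity, which serves when
  \<open>p = 0\<close>; otherwise \<open>y = 1\<close> and the quadratic formula applies.\<close>

lemma complex_binary_quadratic_root:
  fixes p q r :: complex
  obtains x y where "x \<noteq> 0 \<or> y \<noteq> 0" "p * x * x + q * x * y + r * y * y = 0"
proof (cases "p = 0")
  case True
  then show ?thesis using that[of 1 0] by simp
next
  case False
  define s where "s = csqrt (q\<^sup>2 - 4 * p * r)"
  have "4 * p * (p * ((s - q) / (2 * p)) * ((s - q) / (2 * p)) + q * ((s - q) / (2 * p)) + r) =
      (s - q)\<^sup>2 + 2 * q * (s - q) + 4 * p * r"
    using False by (simp add: field_simps power2_eq_square)
  also have "\<dots> = s\<^sup>2 - (q\<^sup>2 - 4 * p * r)"
    by (simp add: algebra_simps power2_eq_square)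
  also have "\<dots> = 0"
    by (simp add: s_def)
  finally show ?thesis
    using False that[of "(s - q) / (2 * p)" 1] by simp
qed

text \<open>
  A singular value decomposition of \<open>N\<close> up to a permutation: \<open>A\<close> makes the columns of \<open>N A\<inverse>\<close>
  orthogonal, then \<open>B\<close> rotates them onto the two basis vectors.
\<close>

lemma antidiagonal_block:
  fixes N :: "bool \<Rightarrow> bool \<Rightarrow> complex"
  obtains \<alpha> \<beta> \<gamma> \<delta> where
    "\<alpha> * cnj \<alpha> + \<beta> * cnj \<beta> = 1" "\<gamma> * cnj \<gamma> + \<delta> * cnj \<delta> = 1"
    "\<And>a. conj_block (su2 \<alpha> \<beta>) (su2 \<gamma> \<delta>) N a a = 0"
proof -
  \<comment> \<open>The entries of the Gram matrix of the columns of \<open>N\<close>. Orthogonality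
    of the columns \<open>u\<close>, \<open>v\<close> of \<open>N A\<inverse>\<close> is a quadratic
    form in \<open>\<alpha>\<close> and \<open>cnj \<beta>\<close> without further conjugates, so it
    has a complex root.\<close>
  define p where "p = cnj (N False False) * N False False + cnj (N True False) * N True False"
  define q where "q = cnj (N False True) * N False True + cnj (N True True) * N True True"
  define z where "z = cnj (N False False) * N False True + cnj (N True False) * N True True"
  obtain x y where xy: "x \<noteq> 0 \<or> y \<noteq> 0" "z * x * x + (p - q) * x * y + (- cnj z) * y * y = 0"
    by (rule complex_binary_quadratic_root)
  obtain r where r: "r * x * cnj (r * x) + r * y * cnj (r * y) = 1" "cnj r = r"
    using normalise_pair[OF xy(1)] by blast
  define \<alpha> \<beta> where "\<alpha> = r * x" and "\<beta> = cnj (r * y)"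
  define u where "u a = N a False * cnj \<alpha> - N a True * \<beta>" for a
  define v where "v a = N a False * cnj \<beta> + N a True * \<alpha>" for a
  have "cnj (u False) * v False + cnj (u True) * v True =
      r * r * (z * x * x + (p - q) * x * y + (- cnj z) * y * y)"
    by (simp add: u_def v_def \<alpha>_def \<beta>_def p_def q_def z_def r(2) algebra_simps)
  then have orth: "cnj (u False) * v False + cnj (u True) * v True = 0"
    by (simp only: xy(2) mult_zero_right)
  \<comment> \<open>\<open>B\<close> has to map \<open>u\<close> and \<open>v\<close> to multiples
    of the second and the first basis vector. It is read off from a nonzero one of them, and
    orthogonality settles the other.\<close>
  obtain \<gamma> \<delta> where g: "\<gamma> * cnj \<gamma> + \<delta> * cnj \<delta> = 1"
      "\<gamma> * u False - cnj \<delta> * u True = 0" "\<delta> * v False + cnj \<gamma> * v True = 0"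
  proof (cases "u False \<noteq> 0 \<or> u True \<noteq> 0")
    case True
    then obtain s where "s * u False * cnj (s * u False) + s * u True * cnj (s * u True) = 1" "cnj s = s"
      using normalise_pair by blast
    moreover have "s * cnj (u False) * v False + s * cnj (u True) * v True = 0"
      using orth by (simp add: mult.assoc flip: distrib_left)
    ultimately show ?thesis
      by (intro that[of "s * u True" "s * cnj (u False)"]) (simp_all add: algebra_simps)
  next
    case u: False
    show ?thesis
    proof (cases "v False \<noteq> 0 \<or> v True \<noteq> 0")
      case True
      then obtain s where "s * v False * cnj (s * v False) + s * v True * cnj (s * v True) = 1" "cnj s = s"
        using normalise_pair by blast
      with u show ?thesis
        by (intro that[of "s * cnj (v False)" "- (s * v True)"]) (simp_all add: algebra_simps)
    next
      case False
      with u show ?thesis by (intro that[of 1 0]) simp_all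
    qed
  qed
  have ab: "\<alpha> * cnj \<alpha> + \<beta> * cnj \<beta> = 1"
    using r by (simp add: \<alpha>_def \<beta>_def algebra_simps)
  have "conj_block (su2 \<alpha> \<beta>) (su2 \<gamma> \<delta>) N a a =
      (if a then \<delta> * v False + cnj \<gamma> * v True else \<gamma> * u False - cnj \<delta> * u True)" for a
    by (simp add: conj_block_def det2_su2[OF ab] su2_def u_def v_def Let_def algebra_simps)
  with g show ?thesis
    by (intro that[OF ab g(1)]) auto
qed

text \<open>\<open>n\<close> gates applied to \<open>c\<close> times a basis state. The scalar is
  left free, even zero, until the norm pins down its modulus; amplitudes count only on strings of
  length \<open>L\<close>.\<close>

inductive prepared :: "nat \<Rightarrow> nat \<Rightarrow> complex \<Rightarrow> (bool list \<Rightarrow> complex) \<Rightarrow> bool" for L where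
  basis: "length x = L \<Longrightarrow> (\<And>y. length y = L \<Longrightarrow> f y = c * of_bool (y = x)) \<Longrightarrow> prepared L 0 c f"
| gate: "prepared L n c f \<Longrightarrow> gate_pair A B \<Longrightarrow> Suc j < L \<Longrightarrow>
    (\<And>y. length y = L \<Longrightarrow> g y = gate_action j A B f y) \<Longrightarrow> prepared L (Suc n) c g"

lemma prepared_zero:
  assumes "\<And>x. length x = L \<Longrightarrow> f x = 0"
  shows "prepared L 0 0 f"
  by (rule prepared.basis[of "replicate L False"]) (simp_all add: assms)

text \<open>The same circuit runs on the last \<open>L\<close> sites, each gate shifted by one,
  beside a first qubit fixed at \<open>b\<close>.\<close>

lemma prepared_extend:
  assumes "prepared L n c g"
    and "\<And>a x. length x = L \<Longrightarrow> f (a # x) = of_bool (a = b) * g x"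
  shows "prepared (Suc L) n c f"
  using assms
proof (induction arbitrary: f)
  case (basis x g c)
  show ?case
  proof (rule prepared.basis)
    show "length (b # x) = Suc L" using basis.hyps by simp
    show "f y = c * of_bool (y = b # x)" if "length y = Suc L" for y
      using that basis by (cases y) auto
  qed
next
  case (gate n c g A B j g')
  have "prepared (Suc L) n c (\<lambda>y. of_bool (hd y = b) * g (tl y))"
    by (rule gate.IH) simp
  then show ?case
  proof (rule prepared.gate)
    show "gate_pair A B" "Suc (Suc j) < Suc L" using gate.hyps by simp_all
    show "f y = gate_action (Suc j) A B (\<lambda>y. of_bool (hd y = b) * g (tl y)) y" if y: "length y = Suc L" for y
    proof (cases y)
      case (Cons a x)
      then show ?thesis
        using y gate.prems[of x a] gate.hyps(4)[of x] by (simp add: gate_action_scale)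
    qed (use y in simp)
  qed
qed

text \<open>Induction on the last site \<open>k\<close> that the annihilator may touch: each gate
  clears that site. Undoing the gates turns a preparation of \<open>f'\<close> into one of
  \<open>f\<close> with \<open>k\<close> more gates.\<close>

lemma disentangle_mode:
  assumes "k < L" "\<exists>k b. w k b \<noteq> 0" "\<And>i b. k < i \<Longrightarrow> w i b = 0"
    and "\<And>x. length x = L \<Longrightarrow> fermion_op w f x = 0" and "gaussian_amplitudes L f"
  shows "\<exists>w' f'. (\<exists>b. w' 0 b \<noteq> 0) \<and> (\<forall>i>0. \<forall>b. w' i b = 0) \<and>
    (\<forall>x. length x = L \<longrightarrow> fermion_op w' f' x = 0) \<and> gaussian_amplitudes L f' \<and>
    (\<forall>n c. prepared L n c f' \<longrightarrow> prepared L (n + k) c f)"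
  using assms
proof (induction k arbitrary: w f)
  case 0
  then show ?case by (metis add_0_right gr0I)
next
  case (Suc k)
  obtain \<alpha> \<beta> \<gamma> \<delta> where
    su2: "\<alpha> * cnj \<alpha> + \<beta> * cnj \<beta> = 1" "\<gamma> * cnj \<gamma> + \<delta> * cnj \<delta> = 1"
    and diag: "\<And>a. conj_block (su2 \<alpha> \<beta>) (su2 \<gamma> \<delta>) (parity_block (w k) (w (Suc k))) a a = 0"
    using antidiagonal_block by blast
  define A B where "A = su2 \<alpha> \<beta>" and "B = su2 \<gamma> \<delta>"
  define A' B' where "A' = su2 (cnj \<alpha>) (- \<beta>)" and "B' = su2 (cnj \<gamma>) (- \<delta>)"
  have su2': "cnj \<alpha> * cnj (cnj \<alpha>) + (- \<beta>) * cnj (- \<beta>) = 1" "cnj \<gamma> * cnj (cnj \<gamma>) + (- \<delta>) * cnj (- \<delta>) = 1"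
    using su2 by (simp_all add: algebra_simps)
  have d: "det2 A = det2 B" "det2 A \<noteq> 0" and pair: "gate_pair A' B'"
    using su2 su2' by (simp_all only: A_def B_def A'_def B'_def gate_pair_def det2_su2 unitary2_su2) simp_all
  define w' where "w' = rotate_modes k A B w"
  define f' where "f' = gate_action k A B f"
  obtain w'' f'' where IH: "\<exists>b. w'' 0 b \<noteq> 0" "\<forall>i>0. \<forall>b. w'' i b = 0"
    "\<forall>x. length x = L \<longrightarrow> fermion_op w'' f'' x = 0" "gaussian_amplitudes L f''"
    "\<forall>n c. prepared L n c f'' \<longrightarrow> prepared L (n + k) c f'"
  proof -
    have "\<exists>w'' f''. (\<exists>b. w'' 0 b \<noteq> 0) \<and> (\<forall>i>0. \<forall>b. w'' i b = 0) \<and>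
      (\<forall>x. length x = L \<longrightarrow> fermion_op w'' f'' x = 0) \<and> gaussian_amplitudes L f'' \<and>
      (\<forall>n c. prepared L n c f'' \<longrightarrow> prepared L (n + k) c f')"
    proof (rule Suc.IH[of w' f'])
      show "k < L" using Suc.prems by simp
      show "\<exists>k b. w' k b \<noteq> 0"
        using Suc.prems(2) rotate_modes_nonzero[where w = w, OF d] unfolding w'_def by blast
      \<comment> \<open>The new coefficients at site \<open>k + 1\<close> are, up to sign, the
        diagonal of the conjugated block, which the choice of gate made zero.\<close>
      show "w' i b = 0" if "k < i" for i b
        using that Suc.prems(3)[of i] diag
        by (cases "i = Suc k") (auto simp: w'_def rotate_modes_def Let_def A_def B_def)
      show "fermion_op w' f' x = 0" if x: "length x = L" for x
      proof -
        have "fermion_op w' f' x = gate_action k A B (fermion_op w f) x"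
          using gate_action_fermion_op[OF d, of k x] x Suc.prems(1) by (simp add: w'_def f'_def)
        also have "\<dots> = gate_action k A B (\<lambda>y. 0) x"
          by (rule gate_action_cong) (simp add: Suc.prems(4) x)
        finally show ?thesis by (simp add: gate_action_zero)
      qed
      show "gaussian_amplitudes L f'"
        using gaussian_amplitudes_gate[OF Suc.prems(5) d Suc.prems(1)] by (simp add: f'_def)
    qed
    then show thesis using that by blast
  qed
  have "prepared L (n + Suc k) c f" if "prepared L n c f''" for n c
  proof -
    have "prepared L (n + k) c f'"
      using IH(5) that by blast
    then have "prepared L (Suc (n + k)) c f"
    proof (rule prepared.gate[OF _ pair Suc.prems(1)])
      show "f y = gate_action k A' B' f' y" if "length y = L" for y
        using gate_action_inverse[of A' A B' B k y f] su2_inverse[OF su2(1)] su2_inverse[OF su2(2)] that Suc.prems(1)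
        by (simp add: f'_def A_def B_def A'_def B'_def)
    qed
    then show ?thesis by simp
  qed
  with IH show ?case by blast
qed

text \<open>
  The \<open>L div 2\<close> gates suffice because the last \<open>L - 1 - L div 2\<close> sites carry at most \<open>L - 1\<close>
  coordinates, so some annihilator is supported on the first \<open>L div 2 + 1\<close> sites.
\<close>

lemma gaussian_amplitudes_imp_prepared:
  assumes "L = 0 \<or> gaussian_amplitudes L f"
  shows "\<exists>n\<le>L\<^sup>2 div 4. \<exists>c. prepared L n c f"
  using assms
proof (induction L arbitrary: f)
  case 0
  \<comment> \<open>Without sites \<open>gaussian_amplitudes\<close> is false, since
    \<open>w\<close> would have to vanish everywhere; hence the disjunct
    \<open>L = 0\<close>.\<close>
  have "prepared 0 0 (f []) f"
    by (rule prepared.basis[of "[]"]) simp_all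
  then show ?case by auto
next
  case (Suc m)
  define k where "k = Suc m div 2"
  \<comment> \<open>Functional \<open>i\<close> reads one coefficient: two consecutive indices cover
    both bits of a site, starting at site \<open>k + 1\<close>.\<close>
  have "\<forall>i. linear_functional (\<lambda>w. w (Suc k + i div 2) (odd i))"
    by (simp add: linear_functional_def)
  then obtain w where w: "\<exists>k b. w k b \<noteq> 0" "\<forall>k\<ge>Suc m. \<forall>b. w k b = 0"
      "\<forall>i. i + 1 < Suc m \<longrightarrow> w (Suc k + i div 2) (odd i) = 0"
      "\<forall>x. length x = Suc m \<longrightarrow> fermion_op w f x = 0"
    using Suc.prems unfolding gaussian_amplitudes_def
    by (elim disjE allE[of _ "\<lambda>i w. w (Suc k + i div 2) (odd i)"]) auto
  have w0: "w i b = 0" if "k < i" for i b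
  proof (cases "i < Suc m")
    case True
    define l where "l = 2 * (i - Suc k) + of_bool b"
    have "l + 1 < Suc m" "Suc k + l div 2 = i" "odd l = b"
      using True that by (auto simp: l_def k_def)
    then show ?thesis using w(3)[rule_format, of l] by simp
  qed (use w(2) in simp)
  have "k < Suc m"
    by (simp add: k_def)
  have G: "gaussian_amplitudes (Suc m) f"
    using Suc.prems by simp
  obtain w' f' where w': "\<exists>b. w' 0 b \<noteq> 0" "\<forall>i>0. \<forall>b. w' i b = 0"
    "\<forall>x. length x = Suc m \<longrightarrow> fermion_op w' f' x = 0" "gaussian_amplitudes (Suc m) f'"
    "\<forall>n c. prepared (Suc m) n c f' \<longrightarrow> prepared (Suc m) (n + k) c f"
    using disentangle_mode[OF \<open>k < Suc m\<close> w(1) w0 w(4)[rule_format] G] by auto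
  obtain b where b: "w' 0 b \<noteq> 0"
    using w'(1) by blast
  have zero: "fermion_op (\<lambda>k. w' (Suc k)) g x = 0" for g x
  proof -
    have "fermion_op (\<lambda>k b. 0) g x = 0" for g x
      by (induction x arbitrary: g) simp_all
    moreover have "(\<lambda>k. w' (Suc k)) = (\<lambda>k b. 0)"
      using w'(2) by (intro ext) simp
    ultimately show ?thesis by simp
  qed
  \<comment> \<open>At \<open>b # x\<close> the one-site annihilator gives
    \<open>w' 0 b * f' ((\<not> b) # x)\<close>, so the first qubit is in the basis state
    \<open>b\<close>.\<close>
  have f'0: "f' ((\<not> b) # x) = 0" if "length x = m" for x
    using w'(3)[rule_format, of "b # x"] that b by (simp add: zero)
  define g where "g x = f' (b # x)" for x
  have f': "f' (a # x) = of_bool (a = b) * g x" if "length x = m" for a x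
    using f'0[OF that] by (cases a; cases b; simp add: g_def)
  obtain n c where nc: "n \<le> m\<^sup>2 div 4" "prepared m n c g"
  proof (cases "\<forall>x. length x = m \<longrightarrow> g x = 0")
    \<comment> \<open>The zero function provides no string \<open>z\<close> for the argument of the
      other case, but it needs no gates.\<close>
    case True
    then have "prepared m 0 0 g" by (simp add: prepared_zero)
    then show ?thesis using that by blast
  next
    case False
    then obtain z where z: "length z = m" "g z \<noteq> 0" by blast
    have "gaussian_amplitudes m g" if "0 < m"
      unfolding gaussian_amplitudes_def
    proof (intro allI impI)
      fix F :: "nat \<Rightarrow> (nat \<Rightarrow> bool \<Rightarrow> complex) \<Rightarrow> complex"
      assume F: "\<forall>i. linear_functional (F i)"
      \<comment> \<open>Annihilators of \<open>g\<close> come from those of \<open>f'\<close> by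
        dropping site 0. The one additional functional available on \<open>m + 1\<close> sites
        forces \<open>v 0 b = 0\<close>.\<close>
      define F' where "F' i v = (case i of 0 \<Rightarrow> v 0 b | Suc i \<Rightarrow> F i (\<lambda>k. v (Suc k)))"
        for i and v :: "nat \<Rightarrow> bool \<Rightarrow> complex"
      have "\<forall>i. linear_functional (F' i)"
        using F by (simp add: linear_functional_def F'_def split: nat.split)
      then obtain v where v: "\<exists>k b. v k b \<noteq> 0" "\<forall>k\<ge>Suc m. \<forall>b. v k b = 0"
          "\<forall>i. i + 1 < Suc m \<longrightarrow> F' i v = 0" "\<forall>x. length x = Suc m \<longrightarrow> fermion_op v f' x = 0"
        using w'(4) unfolding gaussian_amplitudes_def by blast
      have vb: "v 0 b = 0"
        using v(3)[rule_format, of 0] that by (simp add: F'_def)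
      have "fermion_op (\<lambda>k. v (Suc k)) (\<lambda>y. f' ((\<not> b) # y)) z = 0"
        by (rule fermion_op_zero) (simp add: f'0 z(1))
      \<comment> \<open>At \<open>(\<not> b) # z\<close> the operator gives
        \<open>v 0 (\<not> b) * g z\<close>, and \<open>g z\<close> is nonzero. Thus
        \<open>v\<close> stays nonzero after site 0 is dropped.\<close>
      then have "v 0 (\<not> b) = 0"
        using v(4)[rule_format, of "(\<not> b) # z"] z by (simp add: g_def)
      with vb have v0: "v 0 a = 0" for a by (cases a; cases b; simp)
      have "fermion_op (\<lambda>k. v (Suc k)) g x = 0" if "length x = m" for x
        using v(4)[rule_format, of "b # x"] that by (auto simp: v0 g_def[abs_def] split: if_splits)
      moreover have "\<exists>k b. v (Suc k) b \<noteq> 0"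
        using v(1) v0 by (metis not0_implies_Suc)
      moreover have "F i (\<lambda>k. v (Suc k)) = 0" if "i + 1 < m" for i
        using v(3)[rule_format, of "Suc i"] that by (simp add: F'_def)
      ultimately show "\<exists>w. (\<exists>k b. w k b \<noteq> 0) \<and> (\<forall>k\<ge>m. \<forall>b. w k b = 0) \<and>
          (\<forall>i. i + 1 < m \<longrightarrow> F i w = 0) \<and> (\<forall>x. length x = m \<longrightarrow> fermion_op w g x = 0)"
        using v(2) by (intro exI[of _ "\<lambda>k. v (Suc k)"]) simp
    qed
    then show ?thesis
      using Suc.IH[of g] that by blast
  qed
  have "prepared (Suc m) n c f'"
    using prepared_extend[OF nc(2) f'] .
  then have "prepared (Suc m) (n + k) c f"
    using w'(5) by blast
  moreover have "(Suc m)\<^sup>2 div 4 = m\<^sup>2 div 4 + k"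
  proof (cases "even m")
    case True
    then obtain l where "m = 2 * l" by blast
    then show ?thesis by (simp add: k_def power2_eq_square algebra_simps)
  next
    case False
    then obtain l where l: "m = 2 * l + 1" by (metis oddE)
    have "(Suc m)\<^sup>2 = 4 * (l * l + 2 * l + 1)" "m\<^sup>2 = 1 + 4 * (l * l + l)"
      by (simp_all add: l power2_eq_square algebra_simps)
    moreover have "k = l + 1"
      by (simp add: k_def l)
    ultimately show ?thesis by simp
  qed
  ultimately show ?case
    using nc(1) by (intro exI[of _ "n + k"]) auto
qed

section \<open>Norm and phase\<close>

lemma sum_lists_Suc:
  "(\<Sum>x | length x = Suc n. h x) = (\<Sum>x | length x = n. h (False # x) + h (True # x))"
  for h :: "bool list \<Rightarrow> 'a :: comm_monoid_add"
proof -
  have fin: "finite {x :: bool list. length x = n}"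
    using finite_lists_length_eq[of "UNIV :: bool set" n] by simp
  have "{x :: bool list. length x = Suc n} = (#) False ` {x. length x = n} \<union> (#) True ` {x. length x = n}"
    by (auto simp: length_Suc_conv image_iff)
  then have "(\<Sum>x | length x = Suc n. h x) =
      (\<Sum>x\<in>(#) False ` {x. length x = n}. h x) + (\<Sum>x\<in>(#) True ` {x. length x = n}. h x)"
    using fin by (simp only:) (rule sum.union_disjoint, auto)
  then show ?thesis
    by (simp add: sum.reindex sum.distrib)
qed

lemma unitary2_isometry:
  assumes "unitary2 A"
  shows "(A False False * s + A False True * t) * cnj (A False False * s + A False True * t) +
    (A True False * s + A True True * t) * cnj (A True False * s + A True True * t) =
    s * cnj s + t * cnj t"
proof -
  have "(A False False * s + A False True * t) * cnj (A False False * s + A False True * t) +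
    (A True False * s + A True True * t) * cnj (A True False * s + A True True * t) =
    (cnj (A False False) * A False False + cnj (A True False) * A True False) * (s * cnj s) +
    (cnj (A False False) * A False True + cnj (A True False) * A True True) * (t * cnj s) +
    (cnj (A False True) * A False False + cnj (A True True) * A True False) * (s * cnj t) +
    (cnj (A False True) * A False True + cnj (A True True) * A True True) * (t * cnj t)"
    by (simp add: algebra_simps)
  also have "\<dots> = s * cnj s + t * cnj t"
    using assms by (simp add: unitary2_def)
  finally show ?thesis .
qed

text \<open>With the other bits fixed, the amplitudes at 00, 11 and at 01, 10 form two pairs, each
  mapped isometrically by \<open>A\<close> or \<open>B\<close>.\<close>

lemma norm_gate_action:
  assumes "unitary2 A" "unitary2 B" "Suc j < L"
  shows "(\<Sum>x | length x = L. gate_action j A B f x * cnj (gate_action j A B f x)) =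
    (\<Sum>x | length x = L. f x * cnj (f x))"
  using assms(3)
proof (induction j arbitrary: L f)
  case 0
  then have "L = Suc (Suc (L - 2))"
    by simp
  then obtain n where L: "L = Suc (Suc n)"
    by blast
  have *: "a + b + (c + d) = a' + b' + (c' + d')" if "a + d = a' + d'" "c + b = c' + b'"
    for a b c d a' b' c' d' :: complex
  proof -
    have "a + b + (c + d) = (a + d) + (c + b)" by (simp only: ac_simps)
    also have "\<dots> = a' + b' + (c' + d')" unfolding that by (simp only: ac_simps)
    finally show ?thesis .
  qed
  show ?case
    unfolding L sum_lists_Suc
  proof (rule sum.cong[OF refl])
    fix q :: "bool list"
    let ?g = "gate_action 0 A B f"
    have "?g (False # False # q) * cnj (?g (False # False # q)) + ?g (True # True # q) * cnj (?g (True # True # q)) =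
        f (False # False # q) * cnj (f (False # False # q)) + f (True # True # q) * cnj (f (True # True # q))"
      using unitary2_isometry[OF assms(1)] by simp
    moreover have "?g (False # True # q) * cnj (?g (False # True # q)) + ?g (True # False # q) * cnj (?g (True # False # q)) =
        f (False # True # q) * cnj (f (False # True # q)) + f (True # False # q) * cnj (f (True # False # q))"
      using unitary2_isometry[OF assms(2)] by simp
    ultimately show "?g (False # False # q) * cnj (?g (False # False # q)) +
          ?g (True # False # q) * cnj (?g (True # False # q)) +
         (?g (False # True # q) * cnj (?g (False # True # q)) + ?g (True # True # q) * cnj (?g (True # True # q))) =
         f (False # False # q) * cnj (f (False # False # q)) +
         f (True # False # q) * cnj (f (True # False # q)) +
         (f (False # True # q) * cnj (f (False # True # q)) + f (True # True # q) * cnj (f (True # True # q)))"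
      by (rule *)
  qed
next
  case (Suc j)
  then obtain n where L: "L = Suc n" "Suc j < n"
    by (cases L) auto
  show ?case
    unfolding L(1) sum_lists_Suc using Suc.IH[OF L(2)] by (simp add: sum.distrib)
qed

text \<open>Shows that any two preparations of the same amplitudes have scalars of equal
  modulus.\<close>

lemma norm_prepared:
  assumes "prepared L n c f"
  shows "(\<Sum>x | length x = L. f x * cnj (f x)) = c * cnj c"
  using assms
proof induction
  case (basis x f c)
  have fin: "finite {x :: bool list. length x = L}"
    using finite_lists_length_eq[of "UNIV :: bool set" L] by simp
  have "(\<Sum>y | length y = L. f y * cnj (f y)) = (\<Sum>y | length y = L. if y = x then c * cnj c else 0)"
    by (rule sum.cong) (auto simp: basis)
  then show ?case
    using basis fin by simp
next
  case (gate n c f A B j g)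
  have "(\<Sum>x | length x = L. g x * cnj (g x)) =
      (\<Sum>x | length x = L. gate_action j A B f x * cnj (gate_action j A B f x))"
    by (rule sum.cong) (simp_all add: gate)
  then show ?case
    using gate norm_gate_action[of A B j L f] by (simp add: gate_pair_def)
qed

lemma prepared_scale:
  assumes "prepared L n c f" "\<And>x. length x = L \<Longrightarrow> g x = d * f x"
  shows "prepared L n (d * c) g"
  using assms
proof (induction arbitrary: g)
  case (basis x f c)
  then show ?case by (intro prepared.basis[of x]) simp_all
next
  case (gate n c f A B j g')
  have "prepared L n (d * c) (\<lambda>x. d * f x)"
    by (rule gate.IH) simp
  then show ?case
    by (rule prepared.gate[OF _ gate.hyps(2,3)]) (simp add: gate gate_action_scale)
qed

lemma gate_pair_scale:
  assumes "gate_pair A B" "c * cnj c = 1"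
  shows "gate_pair (\<lambda>a b. c * A a b) (\<lambda>a b. c * B a b)"
proof -
  have "unitary2 (\<lambda>a b. c * A a b)" if "unitary2 A" for A
  proof -
    have "cnj (c * A False a) * (c * A False b) + cnj (c * A True a) * (c * A True b) =
      (c * cnj c) * (cnj (A False a) * A False b + cnj (A True a) * A True b)" for a b
      by (simp add: algebra_simps)
    with that assms(2) show ?thesis by (simp add: unitary2_def)
  qed
  moreover have "det2 (\<lambda>a b. c * A a b) = c * c * det2 A" for A
    by (simp add: det2_def algebra_simps)
  ultimately show ?thesis
    using assms(1) by (simp add: gate_pair_def)
qed

text \<open>Multiplying both blocks of the last gate by the phase \<open>c\<close> multiplies both
  determinants by its square, so the gate stays a matchgate. If there is no gate, an identity gate
  is inserted, hence \<open>max 1 n\<close> and \<open>2 \<le> L\<close>.\<close>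

lemma prepared_absorb_phase:
  assumes "prepared L n c f" "c * cnj c = 1" "2 \<le> L"
  shows "prepared L (max 1 n) 1 f"
proof -
  have *: "prepared L (Suc n) 1 g"
    if "prepared L n c f" "gate_pair A B" "Suc j < L" "\<And>y. length y = L \<Longrightarrow> g y = gate_action j A B f y"
    for n f A B j g
  proof -
    have "prepared L n (cnj c * c) (\<lambda>x. cnj c * f x)"
      by (rule prepared_scale[OF that(1)]) simp
    then have "prepared L n 1 (\<lambda>x. cnj c * f x)"
      using assms(2) by (simp add: mult.commute)
    then show ?thesis
    proof (rule prepared.gate[OF _ gate_pair_scale[OF that(2) assms(2)] that(3)])
      show "g y = gate_action j (\<lambda>a b. c * A a b) (\<lambda>a b. c * B a b) (\<lambda>x. cnj c * f x) y"
        if "length y = L" for y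
        using \<open>\<And>y. length y = L \<Longrightarrow> g y = gate_action j A B f y\<close>[OF that] assms(2)
        by (simp add: gate_action_scale gate_action_scale_gate mult.commute[of "cnj c" c]
            flip: mult.assoc)
    qed
  qed
  define I :: "bool \<Rightarrow> bool \<Rightarrow> complex" where "I a b = of_bool (a = b)" for a b
  have "gate_pair I I"
    by (simp add: gate_pair_def unitary2_def I_def all_bool_eq)
  moreover have "f y = gate_action 0 I I f y" if "length y = L" for y
    using that gate_action_inverse[of I I I I 0 y f] assms(3)
    by (cases y rule: remdups_adj.cases) (auto simp: I_def)
  ultimately have 1: "prepared L (Suc n) 1 f"
    using *[OF assms(1), of I I 0 f] assms(3) by simp
  show ?thesis
  proof (cases n)
    case 0
    with 1 show ?thesis by simp
  next
    case (Suc m)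
    from assms(1)[unfolded Suc] have "prepared L (Suc m) 1 f"
      by cases (rule *)
    then show ?thesis using Suc by simp
  qed
qed

section \<open>From matrices to amplitudes\<close>

definition entries :: "complex mat \<Rightarrow> bool \<Rightarrow> bool \<Rightarrow> complex" where
  "entries A a b = A $$ (of_bool a, of_bool b)"

lemma bij_betw_bits_index: "bij_betw bits_index {x. length x = L} {..<2 ^ L}"
proof -
  have inj: "inj_on bits_index {x. length x = L}"
    by (auto simp: inj_on_def bits_index_eq_iff)
  have "card (bits_index ` {x. length x = L}) = 2 ^ L"
    using card_lists_length_eq[of "UNIV :: bool set" L] by (simp add: card_image[OF inj])
  moreover have "bits_index ` {x. length x = L} \<subseteq> {..<2 ^ L}"
    using bits_index_less by auto
  ultimately have "bits_index ` {x. length x = L} = {..<2 ^ L}"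
    by (intro card_subset_eq) auto
  with inj show ?thesis by (simp add: bij_betw_def)
qed

lemma matchgate_carrier: "matchgate A B \<in> carrier_mat 4 4"
  by (auto simp: matchgate_def mat_of_rows_list_def)

lemma matchgate_index:
  "matchgate A B $$ (bits_index [a, b], bits_index [c, d]) =
    (if (a = b) = (c = d) then entries (if a = b then A else B) a c else 0)"
  by (cases a; cases b; cases c; cases d;
    simp add: matchgate_def mat_of_rows_list_def bits_index_def entries_def numeral_2_eq_2 numeral_3_eq_3)

text \<open>The index shift arises because matrices count sites from 1 and amplitudes from
  0.\<close>

lemma local_matchgate_mult:
  assumes "Suc j < L" "\<psi> \<in> carrier_vec (2 ^ L)" "length x = L"
  shows "(local_gate L (Suc j) (matchgate A B) *\<^sub>v \<psi>) $ bits_index x =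
    gate_action j (entries A) (entries B) (\<lambda>y. \<psi> $ bits_index y) x"
proof -
  let ?G = "matchgate A B" and ?U = "local_gate L (Suc j) (matchgate A B)"
  define p where "p = take j x"
  obtain a b q where "drop j x = a # b # q"
  proof -
    have "2 \<le> length (drop j x)" using assms by simp
    then show thesis using that by (cases "drop j x" rule: remdups_adj.cases) auto
  qed
  then have x: "x = p @ [a, b] @ q"
    by (metis append_Cons append_Nil append_take_drop_id p_def)
  have p: "length p = Suc j - 1"
    using assms(1,3) by (simp add: p_def)
  have "length x = length p + 2 + length q"
    unfolding x by simp
  then have q: "length q = L - 1 - Suc j"
    using assms(1,3) p by simp
  have U: "?U \<in> carrier_mat (2 ^ L) (2 ^ L)"
    using assms(1) by (intro dim_local_gate[OF matchgate_carrier]) simp_all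
  have fin: "finite {x :: bool list. length x = L}"
    using finite_lists_length_eq[of "UNIV :: bool set" L] by simp
  have idx: "?U $$ (bits_index x, bits_index (p' @ v @ q')) =
      (if p = p' \<and> q = q' then ?G $$ (bits_index [a, b], bits_index v) else 0)"
    if "length p' = Suc j - 1" "length v = 2" "length q' = L - 1 - Suc j" for p' v q'
    unfolding x using assms(1) p q that by (intro local_gate_index matchgate_carrier) simp_all
  have "(?U *\<^sub>v \<psi>) $ bits_index x = (\<Sum>k<2 ^ L. ?U $$ (bits_index x, k) * \<psi> $ k)"
    using U assms(2) bits_index_less[of x] assms(3)
    by (auto simp: scalar_prod_def lessThan_atLeast0 intro!: sum.cong)
  also have "\<dots> = (\<Sum>y | length y = L. ?U $$ (bits_index x, bits_index y) * \<psi> $ bits_index y)"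
    by (rule sum.reindex_bij_betw[OF bij_betw_bits_index, symmetric])
  \<comment> \<open>Only the four strings that agree with \<open>x\<close> outside the two sites
    contribute.\<close>
  also have "\<dots> = (\<Sum>y\<in>(\<lambda>v. p @ v @ q) ` {v. length v = 2}.
      ?U $$ (bits_index x, bits_index y) * \<psi> $ bits_index y)"
  proof (rule sum.mono_neutral_right[OF fin])
    show "(\<lambda>v. p @ v @ q) ` {v. length v = 2} \<subseteq> {y. length y = L}"
      using p q assms(1) by auto
    show "\<forall>y\<in>{y. length y = L} - (\<lambda>v. p @ v @ q) ` {v. length v = 2}.
        ?U $$ (bits_index x, bits_index y) * \<psi> $ bits_index y = 0"
    proof
      fix y assume y: "y \<in> {y. length y = L} - (\<lambda>v. p @ v @ q) ` {v. length v = 2}"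
      define p' v q' where "p' = take j y" and "v = take 2 (drop j y)" and "q' = drop 2 (drop j y)"
      have y': "y = p' @ v @ q'"
        unfolding p'_def v_def q'_def by (simp only: append_take_drop_id)
      have len: "length p' = Suc j - 1" "length v = 2" "length q' = L - 1 - Suc j"
        using y assms(1) by (auto simp: p'_def v_def q'_def)
      have "\<not> (p = p' \<and> q = q')"
      proof
        assume "p = p' \<and> q = q'"
        then have "y = p @ v @ q" by (simp only: y')
        with y len(2) show False by blast
      qed
      then have "?U $$ (bits_index x, bits_index y) = 0"
        unfolding y' by (simp only: idx[OF len] if_False)
      then show "?U $$ (bits_index x, bits_index y) * \<psi> $ bits_index y = 0" by simp
    qed
  qed
  also have "\<dots> = (\<Sum>v | length v = 2. ?G $$ (bits_index [a, b], bits_index v) * \<psi> $ bits_index (p @ v @ q))"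
    by (subst sum.reindex) (auto simp: inj_on_def idx p q intro!: sum.cong)
  also have "\<dots> = gate_action 0 (entries A) (entries B) (\<lambda>y. \<psi> $ bits_index (p @ y)) ([a, b] @ q)"
    by (cases a; cases b; simp add: numeral_2_eq_2 sum_lists_Suc matchgate_index)
  also have "\<dots> = gate_action j (entries A) (entries B) (\<lambda>y. \<psi> $ bits_index y) x"
    using gate_action_append[of p] p by (simp add: x)
  finally show ?thesis .
qed

lemma unitary_mat_entries:
  assumes "A \<in> carrier_mat 2 2"
  shows "unitary_mat 2 A \<longleftrightarrow> unitary2 (entries A)"
proof -
  have adj: "mat_adjoint A \<in> carrier_mat 2 2"
    using assms by (auto simp: mat_adjoint_def)
  have "mat_adjoint A $$ (i, j) = cnj (A $$ (j, i))" if "i < 2" "j < 2" for i j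
    using assms that by (auto simp: mat_adjoint_def mat_of_rows_def)
  then have "(mat_adjoint A * A) $$ (of_bool a, of_bool b) =
      cnj (entries A False a) * entries A False b + cnj (entries A True a) * entries A True b" for a b
    using assms adj by (auto simp: scalar_prod_def entries_def numeral_2_eq_2)
  moreover have "mat_adjoint A * A = 1\<^sub>m 2 \<longleftrightarrow>
      (\<forall>a b. (mat_adjoint A * A) $$ (of_bool a, of_bool b) = of_bool (a = b))"
    using assms adj by (auto simp: mat_eq_iff less_2_cases_iff all_bool_eq)
  ultimately show ?thesis
    using assms by (simp add: unitary_mat_def unitary2_def)
qed

lemma det_entries:
  assumes "A \<in> carrier_mat 2 2"
  shows "det A = det2 (entries A)"
proof -
  have "det (mat_delete A 0 j) = A $$ (1, 1 - j)" if "j < 2" for j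
    using that assms mat_delete_carrier[OF assms, of 0 j]
    by (subst det_single) (auto simp: mat_delete_def less_2_cases_iff)
  then show ?thesis
    using laplace_expansion_row[OF assms, of 0]
    by (simp add: cofactor_def numeral_2_eq_2 det2_def entries_def)
qed

section \<open>Counting the gates of a Gaussian state\<close>

lemma circuit_carrier:
  assumes "set Us \<subseteq> nn_matchgates L"
  shows "circuit L Us \<in> carrier_mat (2 ^ L) (2 ^ L)"
  using assms
proof (induction Us)
  case (Cons U Us)
  then have "U \<in> carrier_mat (2 ^ L) (2 ^ L)"
    by (auto simp: nn_matchgates_def matchgates_def intro!: dim_local_gate matchgate_carrier)
  with Cons show ?case by (auto simp: circuit_def intro!: mult_carrier_mat)
qed (simp add: circuit_def)

text \<open>The head of the list is the gate applied last, in step with the rule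
  \<open>prepared.gate\<close>.\<close>

lemma circuit_Cons_ket:
  assumes "set (U # Us) \<subseteq> nn_matchgates L" "length x = L"
  shows "circuit L (U # Us) *\<^sub>v ket x = U *\<^sub>v (circuit L Us *\<^sub>v ket x)"
proof -
  have "U \<in> carrier_mat (2 ^ L) (2 ^ L)"
    using assms by (auto simp: nn_matchgates_def matchgates_def intro!: dim_local_gate matchgate_carrier)
  moreover have "circuit L Us \<in> carrier_mat (2 ^ L) (2 ^ L)"
    using assms by (intro circuit_carrier) simp
  ultimately show ?thesis
    using assms by (simp add: circuit_def ket_def assoc_mult_mat_vec[of _ "2 ^ L" "2 ^ L" _ "2 ^ L"])
qed

lemma nn_matchgates_gate_pair:
  assumes "U \<in> nn_matchgates L"
  obtains A B j where "U = local_gate L (Suc j) (matchgate A B)" "Suc j < L"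
    "gate_pair (entries A) (entries B)"
proof -
  obtain A B i where *: "U = local_gate L i (matchgate A B)" "1 \<le> i" "i < L"
      "unitary_mat 2 A" "unitary_mat 2 B" "det A = det B"
    using assms by (auto simp: nn_matchgates_def matchgates_def)
  then have "A \<in> carrier_mat 2 2" "B \<in> carrier_mat 2 2"
    by (simp_all add: unitary_mat_def)
  with * show ?thesis
    by (intro that[of "i - 1" A B]) (simp_all add: gate_pair_def unitary_mat_entries det_entries)
qed

lemma gate_pair_nn_matchgates:
  assumes "gate_pair A B" "Suc j < L"
  obtains A' B' where "local_gate L (Suc j) (matchgate A' B') \<in> nn_matchgates L"
    "entries A' = A" "entries B' = B"
proof -
  define M where "M A = mat 2 2 (\<lambda>(i, j). A (i = 1) (j = 1))" for A :: "bool \<Rightarrow> bool \<Rightarrow> complex"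
  have "M A \<in> carrier_mat 2 2" for A
    by (simp add: M_def)
  moreover have M: "entries (M A) = A" for A
    by (intro ext) (auto simp: entries_def M_def)
  ultimately have "unitary_mat 2 (M A)" "unitary_mat 2 (M B)" "det (M A) = det (M B)"
    using assms(1) by (simp_all add: gate_pair_def unitary_mat_entries det_entries)
  then have "local_gate L (Suc j) (matchgate (M A) (M B)) \<in> nn_matchgates L"
    using assms(2) by (auto simp: nn_matchgates_def matchgates_def)
  with M show ?thesis by (intro that)
qed

lemma ket_index:
  assumes "length y = length x"
  shows "ket x $ bits_index y = of_bool (y = x)"
  using assms bits_index_less[of x] bits_index_less[of y]
  by (simp add: ket_def bits_index_eq_iff)

lemma circuit_imp_prepared:
  assumes "set Us \<subseteq> nn_matchgates L" "length x = L"
  shows "prepared L (length Us) 1 (\<lambda>y. (circuit L Us *\<^sub>v ket x) $ bits_index y)"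
  using assms
proof (induction Us)
  case Nil
  have "ket x \<in> carrier_vec (2 ^ L)"
    using Nil by (simp add: ket_def)
  then show ?case
    using Nil by (auto intro!: prepared.basis[of x] simp: circuit_def ket_index)
next
  case (Cons U Us)
  obtain A B j where U: "U = local_gate L (Suc j) (matchgate A B)" "Suc j < L"
    "gate_pair (entries A) (entries B)"
    by (rule nn_matchgates_gate_pair[of U L]) (use Cons.prems(1) in simp)
  have "circuit L Us *\<^sub>v ket x \<in> carrier_vec (2 ^ L)"
    using Cons.prems circuit_carrier[of Us L] by (simp add: ket_def mult_mat_vec_carrier[of _ _ "2 ^ L"])
  then have *: "(circuit L (U # Us) *\<^sub>v ket x) $ bits_index y =
      gate_action j (entries A) (entries B) (\<lambda>y. (circuit L Us *\<^sub>v ket x) $ bits_index y) y"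
    if "length y = L" for y
    unfolding circuit_Cons_ket[OF Cons.prems] unfolding U(1) using that U(2) by (intro local_matchgate_mult)
  have "prepared L (length Us) 1 (\<lambda>y. (circuit L Us *\<^sub>v ket x) $ bits_index y)"
    using Cons by simp
  from prepared.gate[OF this U(3,2) *] show ?case by simp
qed

lemma prepared_imp_circuit:
  assumes "prepared L n c f" "c = 1"
  shows "\<exists>x Us. length x = L \<and> set Us \<subseteq> nn_matchgates L \<and> length Us = n \<and>
    (\<forall>y. length y = L \<longrightarrow> (circuit L Us *\<^sub>v ket x) $ bits_index y = f y)"
  using assms
proof induction
  case (basis x f c)
  then have "ket x \<in> carrier_vec (2 ^ L)"
    by (simp add: ket_def)
  with basis show ?case
    by (intro exI[of _ x] exI[of _ "[]"]) (simp add: circuit_def ket_index)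
next
  case (gate n c f A B j g)
  then obtain x Us where x: "length x = L" "set Us \<subseteq> nn_matchgates L" "length Us = n"
    "\<forall>y. length y = L \<longrightarrow> (circuit L Us *\<^sub>v ket x) $ bits_index y = f y"
    by blast
  obtain A' B' where AB: "local_gate L (Suc j) (matchgate A' B') \<in> nn_matchgates L"
    "entries A' = A" "entries B' = B"
    using gate_pair_nn_matchgates[OF gate.hyps(2,3)] by blast
  let ?Us = "local_gate L (Suc j) (matchgate A' B') # Us"
  have v: "circuit L Us *\<^sub>v ket x \<in> carrier_vec (2 ^ L)"
    using x circuit_carrier[of Us L] by (simp add: ket_def mult_mat_vec_carrier[of _ _ "2 ^ L"])
  have "(circuit L ?Us *\<^sub>v ket x) $ bits_index y = g y" if y: "length y = L" for y
  proof -
    have "(circuit L ?Us *\<^sub>v ket x) $ bits_index y =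
        gate_action j A B (\<lambda>z. (circuit L Us *\<^sub>v ket x) $ bits_index z) y"
      using circuit_Cons_ket[of "local_gate L (Suc j) (matchgate A' B')" Us L x] x AB
        local_matchgate_mult[OF gate.hyps(3) v y, of A' B'] by simp
    also have "\<dots> = gate_action j A B f y"
      by (rule gate_action_cong) (simp add: x(4) y)
    finally show ?thesis
      using gate.hyps(4)[OF y] by simp
  qed
  then show ?case
    using x AB(1) by (intro exI[of _ x] exI[of _ ?Us]) simp
qed

lemma prepared_imp_gaussian_amplitudes:
  assumes "prepared L n c f" "0 < L"
  shows "gaussian_amplitudes L f"
  using assms
proof induction
  case (basis x f c)
  have "gaussian_amplitudes L (\<lambda>y. c * of_bool (y = x))"
    using basis gaussian_amplitudes_basis[of x c] by simp
  moreover have "fermion_op w f y = fermion_op w (\<lambda>y. c * of_bool (y = x)) y" if "length y = L" for w y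
    by (rule fermion_op_cong) (simp add: basis that)
  ultimately show ?case
    unfolding gaussian_amplitudes_def by simp
next
  case (gate n c f A B j g)
  \<comment> \<open>The left side is the Gram determinant of the columns of \<open>A\<close>, which
    are orthonormal.\<close>
  have "cnj (det2 A) * det2 A = 1" if "unitary2 A" for A
  proof -
    have "cnj (det2 A) * det2 A =
        (cnj (A False False) * A False False + cnj (A True False) * A True False) *
        (cnj (A False True) * A False True + cnj (A True True) * A True True) -
        (cnj (A False False) * A False True + cnj (A True False) * A True True) *
        (cnj (A False True) * A False False + cnj (A True True) * A True False)"
      by (simp add: det2_def algebra_simps)
    then show ?thesis
      using that by (simp add: unitary2_def)
  qed
  then have "det2 A \<noteq> 0"
    using gate.hyps(2) unfolding gate_pair_def by fastforce
  moreover have "det2 A = det2 B"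
    using gate.hyps(2) by (simp add: gate_pair_def)
  ultimately show ?case
    using gaussian_amplitudes_gate[OF gate.IH[OF gate.prems] _ _ gate.hyps(3,4)] by blast
qed

theorem corollary1:
  fixes L :: nat and \<psi> :: "complex vec"
  assumes "1 \<le> L" and "fermionic_gaussian_state L \<psi>"
  shows "\<exists>x Us. length x = L \<and> set Us \<subseteq> nn_matchgates L \<and> length Us \<le> L\<^sup>2 div 4 \<and>
    \<psi> = circuit L Us *\<^sub>v ket x"
proof -
  obtain x Us where \<psi>: "length x = L" "set Us \<subseteq> nn_matchgates L" "\<psi> = circuit L Us *\<^sub>v ket x"
    using assms(2) by (auto simp: fermionic_gaussian_state_def)
  show ?thesis
  proof (cases "L = 1")
    \<comment> \<open>On a single site the given circuit is already empty, so no phase has to be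
      absorbed.\<close>
    case True
    then have "Us = []"
      using \<psi>(2) by (cases Us) (auto simp: nn_matchgates_def)
    with \<psi> show ?thesis by (intro exI[of _ x] exI[of _ "[]"]) simp
  next
    case False
    then have L: "2 \<le> L" using assms(1) by simp
    define f where "f y = \<psi> $ bits_index y" for y
    have f: "prepared L (length Us) 1 f"
      using circuit_imp_prepared[OF \<psi>(2,1)] by (simp add: f_def[abs_def] \<psi>(3))
    then obtain n c where n: "n \<le> L\<^sup>2 div 4" "prepared L n c f"
      using gaussian_amplitudes_imp_prepared[of L f] prepared_imp_gaussian_amplitudes L by auto
    \<comment> \<open>The given circuit prepares \<open>f\<close> with scalar 1, the short one with
      scalar \<open>c\<close>.\<close>
    have "c * cnj c = 1"
      using norm_prepared[OF f] norm_prepared[OF n(2)] by simp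
    then have "prepared L (max 1 n) 1 f"
      using prepared_absorb_phase[OF n(2) _ L] by simp
    then obtain x' Us' where Us': "length x' = L" "set Us' \<subseteq> nn_matchgates L" "length Us' = max 1 n"
      "\<forall>y. length y = L \<longrightarrow> (circuit L Us' *\<^sub>v ket x') $ bits_index y = f y"
      using prepared_imp_circuit by blast
    \<comment> \<open>Leaves room for the one gate that carries the phase when
      \<open>n = 0\<close>.\<close>
    have "2\<^sup>2 \<le> L\<^sup>2"
      using L by (rule power_mono) simp
    then have "max 1 n \<le> L\<^sup>2 div 4"
      using n(1) by simp
    have dim: "dim_vec \<psi> = 2 ^ L" "dim_vec (circuit L Us' *\<^sub>v ket x') = 2 ^ L"
      using circuit_carrier[OF \<psi>(2)] circuit_carrier[OF Us'(2)] by (auto simp: \<psi>(3))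
    have "\<psi> = circuit L Us' *\<^sub>v ket x'"
    proof (rule eq_vecI)
      fix i assume "i < dim_vec (circuit L Us' *\<^sub>v ket x')"
      then have "i \<in> bits_index ` {y. length y = L}"
        using bij_betw_imp_surj_on[OF bij_betw_bits_index[of L]] dim by simp
      then show "\<psi> $ i = (circuit L Us' *\<^sub>v ket x') $ i"
        using Us'(4) by (auto simp: f_def)
    qed (use dim in simp)
    moreover have "length Us' \<le> L\<^sup>2 div 4"
      using \<open>max 1 n \<le> L\<^sup>2 div 4\<close> by (simp only: Us'(3))
    ultimately show ?thesis using Us'(1,2) by blast
  qed
qed

end
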